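(* Let $G$ be a finite group with $|G|\ge3$. (1) For every $k\in\mathbb N$, $\mathcal U_k(G)$ is a finite interval of integers. (2) If $G$ satisfies Property P, then $\Delta(G)$ is a finite interval of integers with $\min\Delta(G)=1$.
   Context: For a finite group $G$ (multiplicative, identity $1_G$), $\mathcal F(G)$ is the free abelian monoid with basis $G$ (sequences $S=g_1\boldsymbol{\cdot}\ldots\boldsymbol{\cdot}g_\ell$, operation $\boldsymbol{\cdot}$). $\pi(S)=\{g_{\tau(1)}\cdots g_{\tau(\ell)}:\tau\text{ a permutation of }[1,\ell]\}$, $\mathcal B(G)=\{S\in\mathcal F(G):1_G\in\pi(S)\}$, $\mathcal A(G)$ its set of atoms. For $A\in\mathcal B(G)$, $\mathsf L(A)=\{k\in\mathbb N: A \text{ is a product of } k \text{ atoms}\}$ ($\mathsf L(1_{\mathcal F(G)})=\{0\}$), and $\mathcal L(G)=\{\mathsf L(A):A\in\mathcal B(G)\}$. For $k\in\mathbb N$, $\mathcal U_k(G)=\bigcup_{L\in\mathcal L(G),\,k\in L}L$. For a finite $L=\{m_1<\dots<m_r\}\subset\mathbb Z$, $\Delta(L)=\{m_i-m_{i-1}:i\in[2,r]\}$, and $\Delta(G)=\bigcup_{L\in\mathcal L(G)}\Delta(L)$. $G$ satisfies Property P if: whenever $U=g_1\boldsymbol{\cdot}\ldots\boldsymbol{\cdot}g_\ell\in\mathcal A(G)$ and $g_1=h_1h_2$ with $h_1,h_2\in G$, the sequence $h_1\boldsymbol{\cdot}h_2\boldsymbol{\cdot}g_2\boldsymbol{\cdot}\ldots\boldsymbol{\cdot}g_\ell$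 is either an atom or a product of two atoms of $\mathcal B(G)$. *)

theory Defs
  imports "HOL-Algebra.Group" "HOL-Library.Multiset"
begin

(* Sequences over G: finite multisets of elements of carrier G (the free abelian monoid F(G)). *)
definition seqs :: "('a, 'b) monoid_scheme \<Rightarrow> 'a multiset set" where
  "seqs G = {S. set_mset S \<subseteq> carrier G}"

definition lprod :: "('a, 'b) monoid_scheme \<Rightarrow> 'a list \<Rightarrow> 'a" where
  "lprod G xs = foldr (\<lambda>x y. x \<otimes>\<^bsub>G\<^esub> y) xs \<one>\<^bsub>G\<^esub>"

definition prodset :: "('a, 'b) monoid_scheme \<Rightarrow> 'a multiset \<Rightarrow> 'a set" where
  "prodset G S = {lprod G xs | xs. mset xs = S}"

definition BG :: "('a, 'b) monoid_scheme \<Rightarrow> 'a multiset set" where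
  "BG G = {S \<in> seqs G. \<one>\<^bsub>G\<^esub> \<in> prodset G S}"

(* A(G): atoms of the monoid B(G) (its only unit is the empty sequence) *)
definition atoms :: "('a, 'b) monoid_scheme \<Rightarrow> 'a multiset set" where
  "atoms G = {A \<in> BG G. A \<noteq> {#} \<and>
      (\<forall>U V. U \<in> BG G \<longrightarrow> V \<in> BG G \<longrightarrow> A = U + V \<longrightarrow> U = {#} \<or> V = {#})}"

(* L(A): set of lengths; L(empty) = {0} *)
definition lengths :: "('a, 'b) monoid_scheme \<Rightarrow> 'a multiset \<Rightarrow> nat set" where
  "lengths G A = {k. \<exists>us. length us = k \<and> set us \<subseteq> atoms G \<and> sum_list us = A}"

definition length_sets :: "('a, 'b) monoid_scheme \<Rightarrow> nat set set" where
  "length_sets G = {lengths G A | A. A \<in> BG G}"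

definition Uk :: "('a, 'b) monoid_scheme \<Rightarrow> nat \<Rightarrow> nat set" where
  "Uk G k = \<Union>{L \<in> length_sets G. k \<in> L}"

definition delta :: "nat set \<Rightarrow> nat set" where
  "delta L = {d. \<exists>m\<in>L. \<exists>m'\<in>L. m < m' \<and> d = m' - m \<and> (\<forall>x\<in>L. \<not> (m < x \<and> x < m'))}"

definition deltaG :: "('a, 'b) monoid_scheme \<Rightarrow> nat set" where
  "deltaG G = \<Union>{delta L | L. L \<in> length_sets G}"

definition propertyP :: "('a, 'b) monoid_scheme \<Rightarrow> bool" where
  "propertyP G = (\<forall>U g1 h1 h2. U \<in> atoms G \<longrightarrow> g1 \<in># U \<longrightarrow>
      h1 \<in> carrier G \<longrightarrow> h2 \<in> carrier G \<longrightarrow> g1 = h1 \<otimes>\<^bsub>G\<^esub> h2 \<longrightarrow>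
      (let T = (U - {#g1#}) + {#h1, h2#} in
        T \<in> atoms G \<or> (\<exists>A1 A2. A1 \<in> atoms G \<and> A2 \<in> atoms G \<and> T = A1 + A2)))"

end

(* Suppose A = V_1 ... V_j = U_1 ... U_k with atoms, j < k and 1_G not in A. If neighbouring terms of each
   V_i (in an order with product one) never lay in different U's, each V_i would meet a single U,
   forcing k <= j. So some V_i has neighbouring terms g, h lying in different U's. Replacing them by
   the single term gh gives a shorter sequence A': the changed V_i is still an atom, and the two U's
   involved merge into one nonempty product-one sequence, so A' has length j and some length >= k - 1.
   Induction on |A| yields every value in [j, k] as a length next to j, which is the upper half of (1);
   the lower half follows by multiplying with copies of the atom 1_G. Under Property P each length r of
   A' gives the length r or r + 1 of A, so a gap in L(A) shrinks by at most one when passing to A', and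
   Delta(G) is closed downwards. Three nontrivial elements g, h, k with ghk = 1 and their inverses
   have lengths 2 and 3, so 1 is a distance. *)
theory Submission
  imports Defs
begin

section \<open>Monotone subsequences and Dickson's lemma\<close>

lemma nat_seq_mono_subseq:
  fixes f :: "nat \<Rightarrow> nat"
  obtains r :: "nat \<Rightarrow> nat" where "strict_mono r" "mono (\<lambda>n. f (r n))"
proof -
  let ?P = "\<lambda>x. \<forall>y \<ge> x. f x \<le> f y"
  \<comment> \<open>Beyond \<open>N\<close>, an index at which \<open>f\<close> takes its least
    value is dominated by all later values; such indices are therefore unbounded and can be
    chained.\<close>
  have ex: "\<exists>x > N. ?P x" for N
  proof -
    obtain x where "N < x" "\<forall>y. N < y \<longrightarrow> f x \<le> f y"
      using ex_has_least_nat[of "\<lambda>x. N < x" "Suc N" f] by auto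
    then show ?thesis by (intro exI[of _ x]) auto
  qed
  have "\<exists>r. \<forall>n. ?P (r n) \<and> r n < r (Suc n)"
    using ex by (intro dependent_nat_choice) blast+
  then obtain r where r: "\<And>n. ?P (r n)" "\<And>n. r n < r (Suc n)" by blast
  then have "strict_mono r" by (simp add: strict_mono_Suc_iff)
  moreover from this have "mono (\<lambda>n. f (r n))"
    using r(1) by (intro monoI) (simp add: strict_mono_less_eq)
  ultimately show thesis by (rule that)
qed

text \<open>Refine one coordinate at a time: a subsequence of a monotone sequence stays monotone, so
  coordinates already treated are not disturbed.\<close>

lemma dickson_mono_subseq:
  fixes f :: "nat \<Rightarrow> 'i \<Rightarrow> nat"
  assumes "finite I"
  shows "\<exists>r :: nat \<Rightarrow> nat. strict_mono r \<and> (\<forall>i \<in> I. mono (\<lambda>n. f (r n) i))"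
  using assms
proof (induction I)
  case empty
  show ?case by (intro exI[of _ id]) (auto simp: strict_mono_def)
next
  case (insert a I)
  then obtain r :: "nat \<Rightarrow> nat" where r: "strict_mono r" "\<forall>i \<in> I. mono (\<lambda>n. f (r n) i)" by blast
  obtain s :: "nat \<Rightarrow> nat" where s: "strict_mono s" "mono (\<lambda>n. f (r (s n)) a)"
    using nat_seq_mono_subseq[of "\<lambda>n. f (r n) a"] by blast
  have "mono (\<lambda>n. f (r (s n)) i)" if "i \<in> I" for i
    using r(2) that s(1) by (auto simp: mono_def strict_mono_less_eq)
  then show ?case
    using s r(1) by (intro exI[of _ "r \<circ> s"]) (auto simp: strict_mono_def)
qed

section \<open>Product-one sequences\<close>

context group
begin

lemma lprod_Nil [simp]: "lprod G [] = \<one>"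
  by (simp add: lprod_def)

lemma lprod_Cons [simp]: "lprod G (x # xs) = x \<otimes> lprod G xs"
  by (simp add: lprod_def)

lemma lprod_closed [simp]: "set xs \<subseteq> carrier G \<Longrightarrow> lprod G xs \<in> carrier G"
  by (induction xs) auto

lemma lprod_append [simp]:
  "set xs \<subseteq> carrier G \<Longrightarrow> set ys \<subseteq> carrier G \<Longrightarrow> lprod G (xs @ ys) = lprod G xs \<otimes> lprod G ys"
  by (induction xs) (auto simp: m_assoc)

lemma lprod_swap_one:
  assumes "set xs \<subseteq> carrier G" "set ys \<subseteq> carrier G" "lprod G (xs @ ys) = \<one>"
  shows "lprod G (ys @ xs) = \<one>"
  using assms inv_comm[of "lprod G xs" "lprod G ys"] by simp

lemma BG_iff: "S \<in> BG G \<longleftrightarrow> (\<exists>xs. set xs \<subseteq> carrier G \<and> mset xs = S \<and> lprod G xs = \<one>)"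
  unfolding BG_def seqs_def prodset_def by force

lemma BG_empty [simp]: "{#} \<in> BG G"
  unfolding BG_iff by (rule exI[of _ "[]"]) simp

lemma BG_add: 
  assumes "S \<in> BG G" "T \<in> BG G" 
  shows "S + T \<in> BG G"
proof -
  obtain xs ys where "set xs \<subseteq> carrier G" "mset xs = S" "lprod G xs = \<one>"
    "set ys \<subseteq> carrier G" "mset ys = T" "lprod G ys = \<one>"
    using assms unfolding BG_iff by blast
  then show ?thesis unfolding BG_iff by (intro exI[of _ "xs @ ys"]) simp
qed

text \<open>In a group xy = 1 implies yx = 1, so an ordering with product one may be rotated until
  any prescribed term stands first.\<close>

lemma BG_cyclic:
  assumes "add_mset g S \<in> BG G"
  obtains xs where "g \<in> carrier G" "set xs \<subseteq> carrier G" "mset xs = S" "g \<otimes> lprod G xs = \<one>"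
proof -
  obtain zs where zs: "set zs \<subseteq> carrier G" "mset zs = add_mset g S" "lprod G zs = \<one>"
    using assms unfolding BG_iff by blast
  then have "g \<in> set zs" by (metis set_mset_mset union_single_eq_member)
  then obtain a b where ab: "zs = a @ g # b" by (meson split_list)
  have car: "set a \<subseteq> carrier G" "g \<in> carrier G" "set b \<subseteq> carrier G"
    using zs(1) ab by auto
  show thesis
  proof
    show "g \<in> carrier G" "set (b @ a) \<subseteq> carrier G" using car by auto
    show "mset (b @ a) = S" using zs(2) ab by (simp add: union_commute)
    have "lprod G ((g # b) @ a) = \<one>"
      using lprod_swap_one[of a "g # b"] zs(3) ab car by simp
    then show "g \<otimes> lprod G (b @ a) = \<one>" by simp
  qed
qed

lemma BG_split:
  assumes "add_mset (g \<otimes> h) S \<in> BG G" "g \<in> carrier G" "h \<in> carrier G"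
  shows "add_mset g (add_mset h S) \<in> BG G"
proof -
  obtain xs where "set xs \<subseteq> carrier G" "mset xs = S" "(g \<otimes> h) \<otimes> lprod G xs = \<one>"
    using BG_cyclic[OF assms(1)] by blast
  then show ?thesis
    unfolding BG_iff using assms(2,3) by (intro exI[of _ "g # h # xs"]) (simp add: m_assoc)
qed

text \<open>Rotate to gx = 1 and hy = 1, with x and y the remaining products, and insert the second
  relation into the first: (gh)yx = g(hy)x = gx = 1.\<close>

lemma BG_merge:
  assumes "add_mset g S \<in> BG G" "add_mset h T \<in> BG G"
  shows "add_mset (g \<otimes> h) (S + T) \<in> BG G"
proof -
  obtain xs where x: "g \<in> carrier G" "set xs \<subseteq> carrier G" "mset xs = S" "g \<otimes> lprod G xs = \<one>"
    using BG_cyclic[OF assms(1)] by blast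
  obtain ys where y: "h \<in> carrier G" "set ys \<subseteq> carrier G" "mset ys = T" "h \<otimes> lprod G ys = \<one>"
    using BG_cyclic[OF assms(2)] by blast
  have "(g \<otimes> h) \<otimes> (lprod G ys \<otimes> lprod G xs) = g \<otimes> ((h \<otimes> lprod G ys) \<otimes> lprod G xs)"
    using x(1,2) y(1,2) by (simp add: m_assoc)
  also have "\<dots> = \<one>" using x y by simp
  finally have "lprod G ((g \<otimes> h) # ys @ xs) = \<one>" using x y by simp
  moreover have "set ((g \<otimes> h) # ys @ xs) \<subseteq> carrier G" 
    "mset ((g \<otimes> h) # ys @ xs) = add_mset (g \<otimes> h) (S + T)"
    using x y by auto
  ultimately show ?thesis unfolding BG_iff by blast
qed

lemma BG_remove_one: "add_mset \<one> S \<in> BG G \<Longrightarrow> S \<in> BG G"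
  by (erule BG_cyclic) (metis BG_iff l_one lprod_closed)

lemma singleton_BG_iff [simp]: "{#g#} \<in> BG G \<longleftrightarrow> g = \<one>"
proof
  assume "{#g#} \<in> BG G"
  then show "g = \<one>" by (rule BG_cyclic[of g "{#}"]) simp
next
  assume "g = \<one>"
  then show "{#g#} \<in> BG G" unfolding BG_iff by (intro exI[of _ "[\<one>]"]) simp
qed

section \<open>Atoms\<close>

lemma atoms_BG: "U \<in> atoms G \<Longrightarrow> U \<in> BG G"
  by (simp add: atoms_def)

lemma atoms_nonempty: "U \<in> atoms G \<Longrightarrow> U \<noteq> {#}"
  by (simp add: atoms_def)

lemma atomD: "A \<in> atoms G \<Longrightarrow> A = U + V \<Longrightarrow> U \<in> BG G \<Longrightarrow> V \<in> BG G \<Longrightarrow> U = {#} \<or> V = {#}"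
  unfolding atoms_def by blast

lemma one_atom [simp]: "{#\<one>#} \<in> atoms G"
  unfolding atoms_def by (auto simp: single_is_union)

lemma atom_one: 
  assumes "U \<in> atoms G" "\<one> \<in># U"
  shows "U = {#\<one>#}"
proof -
  obtain S where S: "U = add_mset \<one> S" using assms(2) by (meson multi_member_split)
  then have "S \<in> BG G" using assms(1) BG_remove_one atoms_BG by blast
  then have "S = {#}" using atomD[OF assms(1), of "{#\<one>#}" S] S by simp
  then show ?thesis using S by simp
qed

text \<open>Because \<open>g\<close> and \<open>h\<close> are neighbours, the merged sequence still
  has product one. A splitting of it would lift to one of \<open>V\<close> by expanding
  \<open>g \<otimes> h\<close> inside the factor that contains it.\<close>

lemma atom_merge:
  assumes "V \<in> atoms G" "mset (a @ g # h # b) = V" "set (a @ g # h # b) \<subseteq> carrier G"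
    "lprod G (a @ g # h # b) = \<one>"
  shows "add_mset (g \<otimes> h) (mset (a @ b)) \<in> atoms G"
proof -
  have main: "V2 = {#}"
    if "add_mset (g \<otimes> h) (mset (a @ b)) = U + V2" "g \<otimes> h \<in># U" "U \<in> BG G" "V2 \<in> BG G" for U V2
  proof -
    obtain U' where U': "U = add_mset (g \<otimes> h) U'" using \<open>g \<otimes> h \<in># U\<close> by (meson multi_member_split)
    then have "add_mset g (add_mset h U') \<in> BG G" using BG_split that assms(3) by auto
    moreover have "V = add_mset g (add_mset h U') + V2" using that U' assms(2) by auto
    ultimately show ?thesis using atomD[OF assms(1)] that(4) by fastforce
  qed
  have "add_mset (g \<otimes> h) (mset (a @ b)) \<in> BG G"
    unfolding BG_iff using assms(3,4)
    by (intro exI[of _ "a @ (g \<otimes> h) # b"]) (auto simp: m_assoc)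
  moreover have "U = {#} \<or> V2 = {#}"
    if "U \<in> BG G" "V2 \<in> BG G" "add_mset (g \<otimes> h) (mset (a @ b)) = U + V2" for U V2
  proof -
    have "g \<otimes> h \<in># U + V2" using that(3) by (metis union_single_eq_member)
    then show ?thesis using main[of U V2] main[of V2 U] that by (auto simp: union_commute)
  qed
  ultimately show ?thesis unfolding atoms_def by auto
qed

text \<open>The classical bound of the Davenport constant by the group order: two equal partial
  products cut out a product-one block, and the terms around it also multiply to one.\<close>

lemma atom_size_le:
  assumes "finite (carrier G)" "U \<in> atoms G"
  shows "size U \<le> card (carrier G)"
proof (rule ccontr)
  assume long: "\<not> ?thesis"
  obtain xs where xs: "set xs \<subseteq> carrier G" "mset xs = U" "lprod G xs = \<one>"
    using assms(2) atoms_BG unfolding BG_iff by blast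
  have sub: "set (take i xs) \<subseteq> carrier G" "set (drop i xs) \<subseteq> carrier G" for i
    using xs(1) set_take_subset set_drop_subset by fastforce+
  let ?p = "\<lambda>i. lprod G (take i xs)"
  \<comment> \<open>The full prefix is left out, so a collision \<open>i < j\<close> has
    \<open>j < length xs\<close> and leaves both the block and its complement nonempty.\<close>
  have "\<not> inj_on ?p {..<length xs}"
  proof
    assume "inj_on ?p {..<length xs}"
    moreover have "?p ` {..<length xs} \<subseteq> carrier G" using sub by auto
    ultimately have "card {..<length xs} \<le> card (carrier G)"
      using card_inj_on_le assms(1) by blast
    then show False using long by (auto simp flip: xs(2))
  qed
  then obtain i j where ij: "i < j" "j < length xs" "?p i = ?p j"
    unfolding inj_on_def by (metis lessThan_iff nat_neq_iff)
  define mid where "mid = drop i (take j xs)"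
  have tj: "take j xs = take i xs @ mid"
    unfolding mid_def using ij by (metis append_take_drop_id min.absorb1 less_imp_le take_take)
  have mid: "set mid \<subseteq> carrier G" using sub(1)[of j] tj by simp
  have "?p i \<otimes> lprod G mid = ?p i" using ij(3) tj sub mid by simp
  then have m1: "lprod G mid = \<one>" using sub mid by simp
  have dec: "xs = take i xs @ mid @ drop j xs"
    using tj by (metis append.assoc append_take_drop_id)
  have "lprod G xs = ?p i \<otimes> lprod G (drop j xs)"
    using arg_cong[OF dec, of "lprod G"] sub mid m1 by simp
  then have "mset (take i xs @ drop j xs) \<in> BG G"
    unfolding BG_iff using sub xs(3) by (intro exI[of _ "take i xs @ drop j xs"]) auto
  moreover have "mset mid \<in> BG G" unfolding BG_iff using mid m1 by blast
  moreover have "U = mset mid + mset (take i xs @ drop j xs)"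
    using arg_cong[OF dec, of mset] xs(2) by simp
  ultimately have "mset mid = {#} \<or> mset (take i xs @ drop j xs) = {#}"
    using atomD[OF assms(2)] by blast
  then show False using ij by (auto simp: mid_def)
qed

lemma finite_atoms: 
  assumes "finite (carrier G)"
  shows "finite (atoms G)"
proof (rule finite_subset)
  show "atoms G \<subseteq> mset ` {xs. set xs \<subseteq> carrier G \<and> length xs \<le> card (carrier G)}"
  proof
    fix U assume U: "U \<in> atoms G"
    obtain xs where "set xs \<subseteq> carrier G" "mset xs = U"
      using U atoms_BG unfolding BG_iff by blast
    then show "U \<in> mset ` {xs. set xs \<subseteq> carrier G \<and> length xs \<le> card (carrier G)}"
      using atom_size_le[OF assms U] by auto
  qed
  show "finite (mset ` {xs. set xs \<subseteq> carrier G \<and> length xs \<le> card (carrier G)})"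
    using finite_lists_length_le[OF assms] by simp
qed

section \<open>Factorizations and sets of lengths\<close>

text \<open>Multisets of atoms allow a chosen factor to be taken out or replaced without tracking
  positions.\<close>

lemma lengths_iff: "k \<in> lengths G A \<longleftrightarrow> (\<exists>M. size M = k \<and> set_mset M \<subseteq> atoms G \<and> sum_mset M = A)"
proof
  assume "k \<in> lengths G A"
  then obtain us where "length us = k" "set us \<subseteq> atoms G" "sum_list us = A"
    unfolding lengths_def by blast
  then show "\<exists>M. size M = k \<and> set_mset M \<subseteq> atoms G \<and> sum_mset M = A"
    by (intro exI[of _ "mset us"]) (auto simp: sum_mset_sum_list)
next
  assume "\<exists>M. size M = k \<and> set_mset M \<subseteq> atoms G \<and> sum_mset M = A"
  then obtain us where "size (mset us) = k" "set us \<subseteq> atoms G" "sum_mset (mset us) = A"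
    by (metis ex_mset set_mset_mset)
  then show "k \<in> lengths G A"
    unfolding lengths_def by (auto simp: sum_mset_sum_list)
qed

lemma sum_atoms_BG: "set_mset M \<subseteq> atoms G \<Longrightarrow> sum_mset M \<in> BG G"
  by (induction M) (auto intro: BG_add atoms_BG)

lemma lengths_BG: "k \<in> lengths G A \<Longrightarrow> A \<in> BG G"
  unfolding lengths_iff using sum_atoms_BG by blast

lemma lengths_add: "j \<in> lengths G A \<Longrightarrow> k \<in> lengths G B \<Longrightarrow> j + k \<in> lengths G (A + B)"
  unfolding lengths_iff by (metis Un_least set_mset_union size_union sum_mset.union)

lemma atom_lengths: "U \<in> atoms G \<Longrightarrow> Suc 0 \<in> lengths G U"
  unfolding lengths_iff by (rule exI[of _ "{#U#}"]) simp

lemma BG_factorization: "A \<in> BG G \<Longrightarrow> \<exists>k. k \<in> lengths G A"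
proof (induction "size A" arbitrary: A rule: less_induct)
  case less
  show ?case
  proof (cases "A = {#}")
    case True
    then have "0 \<in> lengths G A" by (simp add: lengths_def)
    then show ?thesis by blast
  next
    case False
    show ?thesis
    proof (cases "A \<in> atoms G")
      case True
      then show ?thesis using atom_lengths by blast
    next
      case nonatom: False
      then obtain U V where UV: "U \<in> BG G" "V \<in> BG G" "A = U + V" "U \<noteq> {#}" "V \<noteq> {#}"
        using less.prems False unfolding atoms_def by blast
      then have "size U < size A" "size V < size A" by (simp_all add: nonempty_has_size)
      then obtain i j where "i \<in> lengths G U" "j \<in> lengths G V"
        using less.hyps UV by blast
      then show ?thesis using lengths_add UV by blast
    qed
  qed
qed

lemma lengths_le_size: "k \<in> lengths G A \<Longrightarrow> k \<le> size A"
proof -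
  have "size M \<le> size (sum_mset M)" if "set_mset M \<subseteq> atoms G" for M
    using that
  proof (induction M)
    case (add x M)
    then have "size x \<ge> 1" using atoms_nonempty[of x] by (simp add: Suc_le_eq nonempty_has_size)
    then show ?case using add by simp
  qed simp
  then show "k \<in> lengths G A \<Longrightarrow> k \<le> size A" unfolding lengths_iff by blast
qed

lemma size_le_lengths:
  assumes "finite (carrier G)" "k \<in> lengths G A"
  shows "size A \<le> k * card (carrier G)"
proof -
  have "size (sum_mset M) \<le> size M * card (carrier G)" if "set_mset M \<subseteq> atoms G" for M
    using that
  proof (induction M)
    case (add x M)
    then show ?case using atom_size_le[OF assms(1), of x] by simp
  qed simp
  then show ?thesis using assms(2) unfolding lengths_iff by blast
qed

text \<open>An atom containing the identity is the one-term sequence, so this atom occurs in every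
  factorization and can be cancelled. The inductions below use this to reach sequences without the
  identity.\<close>

lemma lengths_add_one_iff: "k \<in> lengths G (add_mset \<one> A) \<longleftrightarrow> (\<exists>l. k = Suc l \<and> l \<in> lengths G A)"
proof
  assume "k \<in> lengths G (add_mset \<one> A)"
  then obtain M where M: "size M = k" "set_mset M \<subseteq> atoms G" "sum_mset M = add_mset \<one> A"
    unfolding lengths_iff by blast
  then obtain u where "u \<in># M" "\<one> \<in># u" by (metis in_Union_mset_iff union_single_eq_member)
  then obtain N where N: "M = add_mset {#\<one>#} N" 
    using M(2) atom_one by (metis multi_member_split subsetD)
  then show "\<exists>l. k = Suc l \<and> l \<in> lengths G A"
    using M unfolding lengths_iff by (intro exI[of _ "size N"]) auto
next
  assume "\<exists>l. k = Suc l \<and> l \<in> lengths G A"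
  then show "k \<in> lengths G (add_mset \<one> A)"
    using lengths_add[OF atom_lengths[OF one_atom]] by fastforce
qed

section \<open>Merging neighbouring terms of two factorizations\<close>

text \<open>The two atoms that are met are given by positions \<open>m\<close> and \<open>n\<close>,
  not by their values, since \<open>us\<close> may contain the same atom twice.\<close>

lemma crossing_pair:
  assumes us: "set us \<subseteq> atoms G" and vs: "set vs \<subseteq> atoms G" 
    and eq: "sum_list us = sum_list vs" and lt: "length vs < length us" 
    and no1: "\<one> \<notin># sum_list vs"
  obtains v g h T m n where "v \<in> set vs" "v = add_mset g (add_mset h T)" 
    "add_mset (g \<otimes> h) T \<in> atoms G" "m < length us" "n < length us" "m \<noteq> n" 
    "g \<in># us ! m" "h \<in># us ! n"
proof (rule ccontr)
  assume "\<not> thesis"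
  note none = this and found = that
  have mem: "\<exists>m < length us. g \<in># us ! m" if "v \<in> set vs" "g \<in># v" for v g
  proof -
    have "g \<in># sum_list us" using that eq by (metis in_Union_mset_iff set_mset_mset sum_mset_sum_list)
    then show ?thesis by (metis in_Union_mset_iff in_set_conv_nth set_mset_mset sum_mset_sum_list)
  qed
  \<comment> \<open>Without a crossing pair, one position is forced on all terms of
    \<open>v\<close>: it passes from each term to its neighbour.\<close>
  have uniq: "\<exists>c. \<forall>g m. g \<in># v \<longrightarrow> m < length us \<longrightarrow> g \<in># us ! m \<longrightarrow> m = c" if v: "v \<in> set vs" for v
  proof -
    obtain xs where xs: "set xs \<subseteq> carrier G" "mset xs = v" "lprod G xs = \<one>"
      using v vs atoms_BG unfolding BG_iff by blast
    have "\<one> \<notin># v" using v no1 by (metis in_Union_mset_iff set_mset_mset sum_mset_sum_list)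
    \<comment> \<open>A one-term atom would be the identity, excluded by \<open>no1\<close>. A
      second term is needed because a lone term could lie in several members of
      \<open>us\<close>.\<close>
    have len: "length xs \<ge> 2"
    proof (rule ccontr)
      assume "\<not> ?thesis"
      then consider "xs = []" | g where "xs = [g]" by (cases xs rule: remdups_adj.cases) auto
      then show False using xs \<open>\<one> \<notin># v\<close> v vs atoms_nonempty by cases auto
    qed
    have adj: "m = n" if p: "Suc p < length xs" and m: "m < length us" "xs ! p \<in># us ! m"
      and n: "n < length us" "xs ! Suc p \<in># us ! n" for p m n
    proof (rule ccontr)
      assume "m \<noteq> n"
      have dec: "xs = take p xs @ xs ! p # xs ! Suc p # drop (Suc (Suc p)) xs"
        using p by (metis Cons_nth_drop_Suc Suc_lessD append_take_drop_id)
      let ?T = "mset (take p xs @ drop (Suc (Suc p)) xs)"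
      have "add_mset (xs ! p \<otimes> xs ! Suc p) ?T \<in> atoms G"
        using v vs xs dec by (intro atom_merge[of v]) auto
      moreover have "v = add_mset (xs ! p) (add_mset (xs ! Suc p) ?T)"
        using arg_cong[OF dec, of mset] xs(2) by simp
      ultimately show False using none found v m n \<open>m \<noteq> n\<close> by blast
    qed
    \<comment> \<open>Reading \<open>c\<close> off at position 1 lets \<open>adj\<close> settle
      position 0 as the base case; from there the induction runs to the right.\<close>
    obtain c where c: "c < length us" "xs ! 1 \<in># us ! c"
      using mem[OF v, of "xs ! 1"] len xs(2) by (metis One_nat_def Suc_le_lessD nth_mem numeral_2_eq_2 set_mset_mset)
    have "\<forall>m. m < length us \<longrightarrow> xs ! p \<in># us ! m \<longrightarrow> m = c" if "p < length xs" for p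
      using that
    proof (induction p)
      case 0
      then show ?case using adj[of 0 _ c] c len by auto
    next
      case (Suc p)
      obtain m where m: "m < length us" "xs ! p \<in># us ! m"
        using mem[OF v, of "xs ! p"] Suc.prems xs(2) by (metis Suc_lessD nth_mem set_mset_mset)
      then have "m = c" using Suc by simp
      then show ?case using adj[OF Suc.prems m] by blast
    qed
    then show ?thesis using xs(2) by (metis in_set_conv_nth set_mset_mset)
  qed
  then obtain c where c: "\<And>v g m. v \<in> set vs \<Longrightarrow> g \<in># v \<Longrightarrow> m < length us \<Longrightarrow> g \<in># us ! m \<Longrightarrow> m = c v"
    by metis
  \<comment> \<open>Each \<open>us ! m\<close> is nonempty and its terms occur in members of
    \<open>vs\<close>, so \<open>c\<close> reaches every position; this contradicts
    \<open>length vs < length us\<close>.\<close>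
  have "{..<length us} \<subseteq> c ` set vs"
  proof
    fix m assume "m \<in> {..<length us}"
    then have m: "m < length us" "us ! m \<in> set us" by auto
    then obtain g where g: "g \<in># us ! m" using us atoms_nonempty by blast
    then have "g \<in># sum_list vs" using m eq by (metis in_Union_mset_iff set_mset_mset sum_mset_sum_list)
    then obtain v where "v \<in> set vs" "g \<in># v" by (metis in_Union_mset_iff set_mset_mset sum_mset_sum_list)
    then show "m \<in> c ` set vs" using c g m by blast
  qed
  then have "card {..<length us} \<le> card (set vs)" by (rule surj_card_le[rotated]) simp
  then show False using lt card_length[of vs] by simp
qed

text \<open>One step of the descent. The Property P clause is an implication in the conclusion, so
  that the same step serves the unions of sets of lengths, where Property P is not assumed, and the
  distances.\<close>

lemma amalgamation:
  assumes "j \<in> lengths G A" "k \<in> lengths G A" "j < k" "\<one> \<notin># A"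
  obtains A' k' where "size A' < size A" "j \<in> lengths G A'" "k' \<in> lengths G A'" "k - 1 \<le> k'"
    "propertyP G \<Longrightarrow> \<forall>r \<in> lengths G A'. r \<in> lengths G A \<or> Suc r \<in> lengths G A"
proof -
  obtain vs where vs: "length vs = j" "set vs \<subseteq> atoms G" "sum_list vs = A"
    using assms(1) unfolding lengths_def by blast
  obtain us where us: "length us = k" "set us \<subseteq> atoms G" "sum_list us = A"
    using assms(2) unfolding lengths_def by blast
  obtain v g h T m n where *: "v \<in> set vs" "v = add_mset g (add_mset h T)" 
    "add_mset (g \<otimes> h) T \<in> atoms G" "m < length us" "n < length us" "m \<noteq> n" 
    "g \<in># us ! m" "h \<in># us ! n"
    using crossing_pair[OF us(2) vs(2)] assms us vs by metis
  have gh: "g \<in> carrier G" "h \<in> carrier G"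
  proof -
    have "v \<in> seqs G" using *(1) vs(2) atoms_BG unfolding BG_def by blast
    then show "g \<in> carrier G" "h \<in> carrier G" using *(2) unfolding seqs_def by auto
  qed
  obtain N where N: "mset vs = add_mset v N" using *(1) by (metis multi_member_split set_mset_mset)
  let ?A' = "add_mset (g \<otimes> h) (T + sum_mset N)"
  have A: "A = add_mset g (add_mset h (T + sum_mset N))"
    using vs(3) N *(2) by (metis sum_mset.add_mset sum_mset_sum_list union_mset_add_mset_left)
  have Nat: "set_mset N \<subseteq> atoms G" using N vs(2) by (metis set_mset_add_mset_insert set_mset_mset insert_subset)
  have sN: "Suc (size N) = j" using N vs(1) by (metis size_add_mset size_mset)
  have j: "j \<in> lengths G ?A'"
    unfolding lengths_iff using Nat sN *(3)
    by (intro exI[of _ "add_mset (add_mset (g \<otimes> h) T) N"]) auto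
  \<comment> \<open>The two atoms may be equal as multisets; \<open>m \<noteq> n\<close> guarantees
    two separate occurrences.\<close>
  have "us ! m \<in># mset us" "us ! n \<in># mset us - {#us ! m#}"
  proof -
    show "us ! m \<in># mset us" using *(4) by simp
    have "mset us = image_mset (nth us) (mset_set {..<length us})"
      by (metis map_nth mset_map mset_upt atLeast0LessThan)
    also have "\<dots> = image_mset (nth us) (add_mset m (mset_set ({..<length us} - {m})))"
      using *(4) by (metis finite_lessThan lessThan_iff mset_set.remove)
    finally show "us ! n \<in># mset us - {#us ! m#}" using *(5,6) by simp
  qed
  then obtain K where K: "mset us = add_mset (us ! m) (add_mset (us ! n) K)"
    by (metis insert_DiffM)
  obtain S1 S2 where S: "us ! m = add_mset g S1" "us ! n = add_mset h S2"
    using *(7,8) by (metis multi_member_split)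
  have "add_mset (g \<otimes> h) (S1 + S2) \<in> BG G"
    using S us(2) *(4,5) by (intro BG_merge) (metis atoms_BG nth_mem subsetD)+
  then obtain t where t: "t \<in> lengths G (add_mset (g \<otimes> h) (S1 + S2))" using BG_factorization by blast
  \<comment> \<open>The merged sequence contains \<open>g \<otimes> h\<close>, so it is nonempty.
    Two atoms are traded for \<open>t \<ge> 1\<close>, and the new length is k - 2 + t, at least k -
    1.\<close>
  have "t \<noteq> 0" using t by (auto simp: lengths_def)
  have "sum_mset K + (S1 + S2) = T + sum_mset N"
  proof -
    have "A = us ! m + (us ! n + sum_mset K)"
      using us(3) K by (metis sum_mset.add_mset sum_mset_sum_list)
    then show ?thesis using A S by (simp add: ac_simps)
  qed
  moreover have "set_mset K \<subseteq> atoms G" using K us(2) by (metis set_mset_add_mset_insert set_mset_mset insert_subset)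
  moreover have "Suc (Suc (size K)) = k" using K us(1) by (metis size_add_mset size_mset)
  ultimately have k': "size K + t \<in> lengths G ?A'" "k - 1 \<le> size K + t"
    using lengths_add[of "size K" "sum_mset K" t, OF _ t] \<open>t \<noteq> 0\<close> by (auto simp: lengths_iff)
  \<comment> \<open>Only the atom \<open>w\<close> holding the merged term changes when this term is
    split back into \<open>g\<close> and \<open>h\<close>; Property P makes it one atom or
    two.\<close>
  have "r \<in> lengths G A \<or> Suc r \<in> lengths G A" if P: "propertyP G" and r: "r \<in> lengths G ?A'" for r
  proof -
    obtain M where M: "size M = r" "set_mset M \<subseteq> atoms G" "sum_mset M = ?A'"
      using r unfolding lengths_iff by blast
    then obtain w where w: "w \<in># M" "g \<otimes> h \<in># w" by (metis in_Union_mset_iff union_single_eq_member)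
    obtain w' where w': "w = add_mset (g \<otimes> h) w'" using w(2) by (metis multi_member_split)
    obtain M' where M': "M = add_mset w M'" using w(1) by (metis multi_member_split)
    let ?W = "add_mset g (add_mset h w')"
    have "w' + sum_mset M' = T + sum_mset N" using M(3) M' w' by simp
    then have AW: "A = ?W + sum_mset M'" using A by simp
    have sM': "size M' \<in> lengths G (sum_mset M')" "Suc (size M') = r"
      using M M' by (auto simp: lengths_iff)
    have "w \<in> atoms G" using w M by blast
    then have "w - {#g \<otimes> h#} + {#g, h#} \<in> atoms G \<or> 
        (\<exists>A1 A2. A1 \<in> atoms G \<and> A2 \<in> atoms G \<and> w - {#g \<otimes> h#} + {#g, h#} = A1 + A2)"
      using P w(2) gh unfolding propertyP_def Let_def by blast
    moreover have "w - {#g \<otimes> h#} + {#g, h#} = ?W" using w' by simp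
    ultimately consider "?W \<in> atoms G" | A1 A2 where "A1 \<in> atoms G" "A2 \<in> atoms G" "?W = A1 + A2"
      by auto
    then show ?thesis
    proof cases
      case 1
      then show ?thesis using lengths_add[OF atom_lengths sM'(1)] sM'(2) AW by fastforce
    next
      case 2
      then show ?thesis 
        using lengths_add[OF lengths_add[OF atom_lengths atom_lengths] sM'(1)] sM'(2) AW by fastforce
    qed
  qed
  then show thesis using that[of ?A' "size K + t"] j k' A by simp
qed

section \<open>Unions of sets of lengths\<close>

text \<open>The witness \<open>B\<close> varies with \<open>l\<close>. Induction on the size of
  \<open>A\<close>: cancel an identity if there is one, otherwise amalgamate, which keeps
  \<open>j\<close> and lowers the larger length by at most one, so that it does not fall below
  \<open>l\<close>.\<close>

lemma lengths_interpolate: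
  assumes "j \<in> lengths G A" "k \<in> lengths G A" "j \<le> l" "l \<le> k"
  shows "\<exists>B. j \<in> lengths G B \<and> l \<in> lengths G B"
  using assms
proof (induction "size A" arbitrary: A j k l rule: less_induct)
  case less
  show ?case
  proof (cases "l = k")
    case True
    then show ?thesis using less.prems by blast
  next
    case False
    show ?thesis
    proof (cases "\<one> \<in># A")
      case True
      then obtain A0 where A0: "A = add_mset \<one> A0" by (metis multi_member_split)
      then obtain j' k' where jk: "j = Suc j'" "k = Suc k'" "j' \<in> lengths G A0" "k' \<in> lengths G A0"
        using less.prems lengths_add_one_iff by metis
      then obtain B where "j' \<in> lengths G B" "l - 1 \<in> lengths G B"
        using less.hyps[of A0 j' k' "l - 1"] less.prems A0 by fastforce
      moreover have "l = Suc (l - 1)" using jk less.prems by simp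
      ultimately have "j \<in> lengths G (add_mset \<one> B)" "l \<in> lengths G (add_mset \<one> B)"
        using jk unfolding lengths_add_one_iff by blast+
      then show ?thesis by blast
    next
      case no1: False
      have "j < k" "l \<le> k - 1" using False less.prems by auto
      then obtain A' k' where "size A' < size A" "j \<in> lengths G A'" "k' \<in> lengths G A'" "k - 1 \<le> k'"
        using amalgamation[OF less.prems(1,2) _ no1] by metis
      then show ?thesis using less.hyps[of A' j k' l] less.prems \<open>l \<le> k - 1\<close> by simp
    qed
  qed
qed

lemma Uk_iff: "l \<in> Uk G k \<longleftrightarrow> (\<exists>A. k \<in> lengths G A \<and> l \<in> lengths G A)"
  unfolding Uk_def length_sets_def using lengths_BG by blast

lemma lengths_add_ones: "k \<in> lengths G A \<Longrightarrow> n + k \<in> lengths G (replicate_mset n \<one> + A)"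
  by (induction n) (auto simp: lengths_add_one_iff)

lemma Uk_self: "k \<in> Uk G k"
  using lengths_add_ones[of 0 "{#}" k] unfolding Uk_iff by (auto simp: lengths_def)

text \<open>Interpolation fixes the smaller length. This suffices above \<open>k\<close>; below
  \<open>k\<close> the fixed length is \<open>a\<close>, and a shift by identities is
  needed.\<close>

lemma Uk_between_self:
  assumes "a \<in> Uk G k" "a \<le> l \<and> l \<le> k \<or> k \<le> l \<and> l \<le> a"
  shows "l \<in> Uk G k"
proof -
  obtain A where A: "k \<in> lengths G A" "a \<in> lengths G A" using assms(1) unfolding Uk_iff by blast
  show ?thesis
  proof (cases "k \<le> l \<and> l \<le> a")
    case True
    then show ?thesis using lengths_interpolate A unfolding Uk_iff by blast
  next
    case False
    then have l: "a \<le> l" "l \<le> k" using assms(2) by auto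
    \<comment> \<open>The difference k - l is realized above \<open>a\<close>; then l - a copies of
      the identity move the pair a, a + (k - l) to l, k.\<close>
    then obtain B where "a \<in> lengths G B" "a + (k - l) \<in> lengths G B"
      using lengths_interpolate[OF A(2,1), of "a + (k - l)"] by fastforce
    then have "l \<in> lengths G (replicate_mset (l - a) \<one> + B)" 
      "k \<in> lengths G (replicate_mset (l - a) \<one> + B)"
      using lengths_add_ones[of a B "l - a"] lengths_add_ones[of "a + (k - l)" B "l - a"] l by auto
    then show ?thesis unfolding Uk_iff by blast
  qed
qed

text \<open>Atoms have between one and |G| terms, so a sequence with a factorization of length
  \<open>k\<close> has at most k|G| terms, which bounds all its lengths.\<close>

lemma finite_Uk:
  assumes "finite (carrier G)"
  shows "finite (Uk G k)"
proof (rule finite_subset)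
  show "Uk G k \<subseteq> {..k * card (carrier G)}"
  proof
    fix l assume "l \<in> Uk G k"
    then obtain A where "k \<in> lengths G A" "l \<in> lengths G A" unfolding Uk_iff by blast
    then have "size A \<le> k * card (carrier G)" "l \<le> size A"
      using size_le_lengths[OF assms] lengths_le_size by blast+
    then show "l \<in> {..k * card (carrier G)}" by simp
  qed
qed simp

lemma Uk_interval:
  assumes "finite (carrier G)"
  shows "\<exists>a b. Uk G k = {a..b}"
proof -
  have fin: "finite (Uk G k)" and ne: "Uk G k \<noteq> {}" using finite_Uk[OF assms] Uk_self by auto
  have "l \<in> Uk G k" if "Min (Uk G k) \<le> l" "l \<le> Max (Uk G k)" for l
  proof (cases "l \<le> k")
    case True
    then show ?thesis using Uk_between_self[OF Min_in[OF fin ne], of l] that by simp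
  next
    case False
    then show ?thesis using Uk_between_self[OF Max_in[OF fin ne], of l] that by simp
  qed
  then have "{Min (Uk G k)..Max (Uk G k)} \<subseteq> Uk G k" by (meson atLeastAtMost_iff subsetI)
  moreover have "Uk G k \<subseteq> {Min (Uk G k)..Max (Uk G k)}"
    using fin by (meson Max_ge Min_le atLeastAtMost_iff subsetI)
  ultimately have "Uk G k = {Min (Uk G k)..Max (Uk G k)}" by (rule subset_antisym[rotated])
  then show ?thesis by blast
qed

section \<open>The set of distances\<close>

lemma deltaG_iff: "d \<in> deltaG G \<longleftrightarrow> 
    (\<exists>A m. 0 < d \<and> m \<in> lengths G A \<and> m + d \<in> lengths G A \<and> (\<forall>x \<in> lengths G A. \<not> (m < x \<and> x < m + d)))"
proof
  assume "d \<in> deltaG G"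
  then obtain A m m' where "m \<in> lengths G A" "m' \<in> lengths G A" "m < m'" "d = m' - m" 
    "\<forall>x \<in> lengths G A. \<not> (m < x \<and> x < m')"
    unfolding deltaG_def delta_def length_sets_def by blast
  then show "\<exists>A m. 0 < d \<and> m \<in> lengths G A \<and> m + d \<in> lengths G A \<and> 
      (\<forall>x \<in> lengths G A. \<not> (m < x \<and> x < m + d))"
    by (intro exI[of _ A] exI[of _ m]) simp
next
  assume "\<exists>A m. 0 < d \<and> m \<in> lengths G A \<and> m + d \<in> lengths G A \<and> 
      (\<forall>x \<in> lengths G A. \<not> (m < x \<and> x < m + d))"
  then obtain A m where "0 < d" "m \<in> lengths G A" "m + d \<in> lengths G A"
      "\<forall>x \<in> lengths G A. \<not> (m < x \<and> x < m + d)" by blast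
  then have "d \<in> delta (lengths G A)"
    unfolding delta_def mem_Collect_eq
    by (rule_tac bexI[of _ m], rule_tac bexI[of _ "m + d"]) simp_all
  moreover have "A \<in> BG G" using lengths_BG \<open>m \<in> lengths G A\<close> by blast
  ultimately show "d \<in> deltaG G" unfolding deltaG_def length_sets_def by blast
qed

text \<open>The gap above \<open>m\<close> shrinks by at most one per amalgamation while the
  sequence gets shorter, so it cannot jump over the value \<open>e\<close>.\<close>

lemma gap_descent:
  assumes P: "propertyP G" and "0 < e" "m \<in> lengths G A" "m' \<in> lengths G A" "m + e \<le> m'"
    "\<forall>x \<in> lengths G A. \<not> (m < x \<and> x < m')"
  shows "e \<in> deltaG G"
  using assms(2-)
proof (induction "size A" arbitrary: A m m' rule: less_induct)
  case less
  show ?case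
  proof (cases "m' = m + e")
    case True
    then show ?thesis unfolding deltaG_iff using less.prems by blast
  next
    case False
    show ?thesis
    proof (cases "\<one> \<in># A")
      case True
      then obtain A0 where A0: "A = add_mset \<one> A0" by (metis multi_member_split)
      then obtain j k where jk: "m = Suc j" "m' = Suc k" "j \<in> lengths G A0" "k \<in> lengths G A0"
        using less.prems lengths_add_one_iff by metis
      have "\<forall>x \<in> lengths G A0. \<not> (j < x \<and> x < k)"
      proof
        fix x assume "x \<in> lengths G A0"
        then have "Suc x \<in> lengths G A" using A0 lengths_add_one_iff by blast
        then have "\<not> (m < Suc x \<and> Suc x < m')" using less.prems(5) by blast
        then show "\<not> (j < x \<and> x < k)" using jk by simp
      qed
      moreover have "size A0 < size A" "j + e \<le> k" using A0 jk less.prems(4) by simp_all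
      ultimately show ?thesis using less.hyps less.prems(1) jk by blast
    next
      case no1: False
      have lt: "m < m'" using less.prems by simp
      obtain A' k' where A': "size A' < size A" "m \<in> lengths G A'" "k' \<in> lengths G A'" "m' - 1 \<le> k'"
        "\<forall>r \<in> lengths G A'. r \<in> lengths G A \<or> Suc r \<in> lengths G A"
        using amalgamation[OF less.prems(2,3) lt no1] P by metis
      \<comment> \<open>The next length of \<open>A'\<close> after \<open>m\<close>. It exists
        because the gap exceeds \<open>e \<ge> 1\<close>, whence k' \<ge> m' - 1 > m.\<close>
      define m'' where "m'' = (LEAST x. x \<in> lengths G A' \<and> m < x)"
      have "m < k'" using A'(4) False less.prems by linarith
      then have m'': "m'' \<in> lengths G A'" "m < m''" 
        using LeastI[of "\<lambda>x. x \<in> lengths G A' \<and> m < x" k'] A' unfolding m''_def by auto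
      have gap: "\<forall>x \<in> lengths G A'. \<not> (m < x \<and> x < m'')"
        unfolding m''_def using not_less_Least by blast
      \<comment> \<open>Otherwise \<open>m''\<close> and \<open>Suc m''\<close> both lie strictly
        inside the gap of \<open>A\<close>, although one of them is a length of
        \<open>A\<close>.\<close>
      have "m' \<le> Suc m''"
      proof (rule ccontr)
        assume "\<not> ?thesis"
        then have "m < m'' \<and> m'' < m'" "m < Suc m'' \<and> Suc m'' < m'" using m''(2) by linarith+
        then show False using A'(5) m''(1) less.prems(5) by blast
      qed
      then have "m + e \<le> m''" using False less.prems(4) by linarith
      then show ?thesis using less.hyps[OF A'(1) less.prems(1) A'(2) m''(1)] gap by blast
    qed
  qed
qed

text \<open>If the distances are unbounded, pick pairs of factorizations with gaps growing without bound.
  By Dickson's lemma one pair of the sequence is contained in arbitrarily late ones, and exchanging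
  it inside a late pair yields a factorization whose length lies in the forbidden gap.\<close>

lemma deltaG_bounded:
  assumes "finite (carrier G)"
  shows "\<exists>D. \<forall>d \<in> deltaG G. d \<le> D"
proof (rule ccontr)
  assume unbounded: "\<not> ?thesis"
  \<comment> \<open>Truncated subtraction is harmless here: \<open>n < size Y - size X\<close>
    already forces \<open>size X < size Y\<close>.\<close>
  define bad where "bad n X Y \<longleftrightarrow> n < size Y - size X \<and>
      set_mset X \<subseteq> atoms G \<and> set_mset Y \<subseteq> atoms G \<and> sum_mset X = sum_mset Y \<and>
      (\<forall>Z. set_mset Z \<subseteq> atoms G \<longrightarrow> sum_mset Z = sum_mset X \<longrightarrow>
        \<not> (size X < size Z \<and> size Z < size Y))" for n X Y
  have "\<exists>X Y. bad n X Y" for n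
  proof -
    obtain d where "d \<in> deltaG G" "n < d" using unbounded by (meson not_le)
    then obtain A m where Am: "m \<in> lengths G A" "m + d \<in> lengths G A"
      "\<forall>x \<in> lengths G A. \<not> (m < x \<and> x < m + d)"
      unfolding deltaG_iff by blast
    obtain X where X: "size X = m" "set_mset X \<subseteq> atoms G" "sum_mset X = A"
      using Am(1) unfolding lengths_iff by blast
    obtain Y where Y: "size Y = m + d" "set_mset Y \<subseteq> atoms G" "sum_mset Y = A"
      using Am(2) unfolding lengths_iff by blast
    have "\<not> (size X < size Z \<and> size Z < size Y)" if "set_mset Z \<subseteq> atoms G" "sum_mset Z = A" for Z
    proof -
      have "size Z \<in> lengths G A" unfolding lengths_iff using that by (intro exI[of _ Z]) simp
      then have "\<not> (m < size Z \<and> size Z < m + d)" using Am(3) by blast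
      then show ?thesis unfolding X(1) Y(1) .
    qed
    moreover have "n < size Y - size X" "sum_mset X = sum_mset Y" using X(1,3) Y(1,3) \<open>n < d\<close> by simp_all
    ultimately have "bad n X Y" unfolding bad_def using X(2,3) Y(2) by blast
    then show ?thesis by blast
  qed
  then obtain X Y where "\<And>n. bad n (X n) (Y n)" by metis
  then have XY: "n < size (Y n) - size (X n)" "set_mset (X n) \<subseteq> atoms G" "set_mset (Y n) \<subseteq> atoms G"
    "sum_mset (X n) = sum_mset (Y n)"
    "\<And>Z. set_mset Z \<subseteq> atoms G \<Longrightarrow> sum_mset Z = sum_mset (X n) \<Longrightarrow> 
      \<not> (size (X n) < size Z \<and> size Z < size (Y n))" for n
    unfolding bad_def by blast+
  let ?f = "\<lambda>n i. case i of Inl a \<Rightarrow> count (X n) a | Inr a \<Rightarrow> count (Y n) a"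
  have "finite (atoms G <+> atoms G)" using finite_atoms[OF assms] by simp
  then obtain r :: "nat \<Rightarrow> nat" where r: "strict_mono r" "\<forall>i \<in> atoms G <+> atoms G. mono (\<lambda>n. ?f (r n) i)"
    using dickson_mono_subseq[of _ ?f] by blast
  define p where "p = r 0"
  \<comment> \<open>Chosen late enough that n \<ge> \<open>size (Y p)\<close>, so the gap of pair
    \<open>n\<close> is larger than \<open>size (Y p)\<close>.\<close>
  define n where "n = r (size (Y p))"
  have "count (X p) a \<le> count (X n) a" for a
  proof (cases "a \<in> atoms G")
    case True
    then have "mono (\<lambda>n. ?f (r n) (Inl a))" using r(2) by blast
    then have "?f (r 0) (Inl a) \<le> ?f (r (size (Y p))) (Inl a)" by (rule monoD) simp
    then show ?thesis by (simp add: p_def n_def)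
  next
    case False
    then have "a \<notin># X p" using XY(2) by blast
    then show ?thesis by (simp add: not_in_iff)
  qed
  then have sX: "X p \<subseteq># X n" by (simp add: subseteq_mset_def)
  \<comment> \<open>The exchange lengthens \<open>X n\<close> by
    \<open>size (Y p) - size (X p)\<close>, a positive amount smaller than the gap of pair
    \<open>n\<close>.\<close>
  let ?Z = "X n - X p + Y p"
  have Xn: "X n = X n - X p + X p" using sX by simp
  have "sum_mset ?Z = sum_mset (X n)"
    using arg_cong[OF Xn, of sum_mset] XY(4)[of p] by simp
  moreover have "set_mset ?Z \<subseteq> atoms G"
    using XY(2)[of n] XY(3)[of p] by (auto dest: in_diffD)
  ultimately have "\<not> (size (X n) < size ?Z \<and> size ?Z < size (Y n))" using XY(5) by blast
  moreover have "size (X n) < size ?Z"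
    using arg_cong[OF Xn, of size] XY(1)[of p] by simp
  moreover have "size ?Z < size (Y n)"
  proof -
    have "size (Y p) \<le> n" unfolding n_def using r(1) by (rule strict_mono_imp_increasing)
    then have "size (Y p) < size (Y n) - size (X n)" using XY(1)[of n] by linarith
    then show ?thesis using arg_cong[OF Xn, of size] by simp
  qed
  ultimately show False by blast
qed

section \<open>Distance one and the interval of distances\<close>

text \<open>Splitting at most three terms into two nonempty parts leaves a part with a single term,
  and a single term with product one is the identity.\<close>

lemma atom_no_one:
  assumes "S \<in> BG G" "S \<noteq> {#}" "\<one> \<notin># S" "size S \<le> 3"
  shows "S \<in> atoms G"
proof -
  have "U = {#} \<or> V = {#}" if "U \<in> BG G" "V \<in> BG G" "S = U + V" for U V
  proof (rule ccontr)
    assume "\<not> ?thesis"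
    then have "size U = 1 \<or> size V = 1"
      using that(3) assms(4) nonempty_has_size[of U] nonempty_has_size[of V] by auto
    then obtain g where "U = {#g#} \<or> V = {#g#}" by (meson size_1_singleton_mset)
    then show False using that assms(3) by auto
  qed
  then show ?thesis using assms unfolding atoms_def by blast
qed

lemma one_in_deltaG:
  assumes "finite (carrier G)" "card (carrier G) \<ge> 3"
  shows "1 \<in> deltaG G"
proof -
  have pick: "\<exists>x. x \<in> carrier G \<and> x \<notin> F" if "finite F" "card F \<le> 2" for F
  proof (rule ccontr)
    assume "\<not> ?thesis"
    then have "card (carrier G) \<le> card F" using that by (intro card_mono) auto
    then show False using assms(2) that(2) by simp
  qed
  obtain g where g: "g \<in> carrier G" "g \<noteq> \<one>" using pick[of "{\<one>}"] by auto
  \<comment> \<open>Avoiding \<open>inv g\<close> makes \<open>g \<otimes> h\<close>, and hence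
    \<open>k\<close>, nontrivial. The choice h = g is allowed, as is necessary in the group of order
    three.\<close>
  obtain h where h: "h \<in> carrier G" "h \<noteq> \<one>" "h \<noteq> inv g" 
    using pick[of "{\<one>, inv g}"] card_insert_le_m1[of 2 "{inv g}" "\<one>"] by auto
  define k where "k = inv (g \<otimes> h)"
  have "g \<otimes> h \<noteq> \<one>" using g h inv_equality[of h g] inv_comm[of g h] by auto
  then have k: "k \<in> carrier G" "k \<noteq> \<one>" "g \<otimes> (h \<otimes> k) = \<one>"
    using g h unfolding k_def by (simp_all add: inv_eq_1_iff flip: m_assoc)
  have pair: "{#x, inv x#} \<in> atoms G" if "x \<in> carrier G" "x \<noteq> \<one>" for x
  proof (rule atom_no_one)
    show "{#x, inv x#} \<in> BG G"
      unfolding BG_iff using that by (intro exI[of _ "[x, inv x]"]) simp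
    show "\<one> \<notin># {#x, inv x#}" using that by (auto dest!: sym[of \<one>])
  qed simp_all
  have U: "{#g, h, k#} \<in> atoms G"
  proof (rule atom_no_one)
    show "{#g, h, k#} \<in> BG G"
      unfolding BG_iff using g h k by (intro exI[of _ "[g, h, k]"]) simp
  qed (use g h k in auto)
  \<comment> \<open>The inverses are listed in reverse order because \<open>G\<close> need not be
    abelian.\<close>
  have "lprod G [inv k, inv h, inv g] = inv (g \<otimes> (h \<otimes> k))"
    using g(1) h(1) k(1) by (simp add: inv_mult_group m_assoc)
  also have "\<dots> = \<one>" by (simp only: k(3) inv_one)
  finally have one: "lprod G [inv k, inv h, inv g] = \<one>" .
  have V: "{#inv k, inv h, inv g#} \<in> atoms G"
  proof (rule atom_no_one)
    show "{#inv k, inv h, inv g#} \<in> BG G"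
      unfolding BG_iff by (rule exI, rule conjI[OF _ conjI[OF _ one]]) (use g h k in simp_all)
    show "\<one> \<notin># {#inv k, inv h, inv g#}" using g h k by (auto dest!: sym[of \<one>])
  qed simp_all
  let ?A = "{#g, h, k#} + {#inv k, inv h, inv g#}"
  have "2 \<in> lengths G ?A"
    using lengths_add[OF atom_lengths[OF U] atom_lengths[OF V]] by (simp add: numeral_2_eq_2)
  moreover have "3 \<in> lengths G ?A"
    using pair g h k unfolding lengths_iff
    by (intro exI[of _ "{#{#g, inv g#}, {#h, inv h#}, {#k, inv k#}#}"]) (simp add: add_mset_commute)
  ultimately show ?thesis unfolding deltaG_iff by (intro exI[of _ ?A] exI[of _ 2]) auto
qed

lemma deltaG_interval:
  assumes "finite (carrier G)" "card (carrier G) \<ge> 3" "propertyP G"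
  shows "\<exists>b \<ge> 1. deltaG G = {1..b}"
proof -
  obtain D where "\<forall>d \<in> deltaG G. d \<le> D" using deltaG_bounded[OF assms(1)] by blast
  then have fin: "finite (deltaG G)" using finite_subset[of "deltaG G" "{..D}"] by blast
  have one: "1 \<in> deltaG G" using one_in_deltaG assms by blast
  have "e \<in> deltaG G" if "1 \<le> e" "e \<le> Max (deltaG G)" for e
  \<comment> \<open>A pair of lengths realizing the largest distance has a gap of at least
    \<open>e\<close>, and the descent produces \<open>e\<close> from it.\<close>
  proof -
    have "Max (deltaG G) \<in> deltaG G" using fin one by (intro Max_in) auto
    then obtain A m where "m \<in> lengths G A" "m + Max (deltaG G) \<in> lengths G A" 
      "\<forall>x \<in> lengths G A. \<not> (m < x \<and> x < m + Max (deltaG G))"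
      unfolding deltaG_iff by blast
    then show ?thesis using gap_descent[OF assms(3)] that by simp
  qed
  then have "{1..Max (deltaG G)} \<subseteq> deltaG G" by (meson atLeastAtMost_iff subsetI)
  moreover have "deltaG G \<subseteq> {1..Max (deltaG G)}"
  proof
    fix d assume "d \<in> deltaG G"
    moreover from this have "0 < d" unfolding deltaG_iff by blast
    ultimately show "d \<in> {1..Max (deltaG G)}" using fin by simp
  qed
  ultimately have "deltaG G = {1..Max (deltaG G)}" by (rule subset_antisym[rotated])
  moreover have "1 \<le> Max (deltaG G)" using fin one by simp
  ultimately show ?thesis by blast
qed

end

theorem theorem5p5:
  fixes G :: "('a, 'b) monoid_scheme"
  assumes "group G" and "finite (carrier G)" and "card (carrier G) \<ge> 3"
  shows "(\<forall>k::nat. k \<ge> 1 \<longrightarrow> (\<exists>a b. Uk G k = {a..b}))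
     \<and> (propertyP G \<longrightarrow> (\<exists>b::nat. b \<ge> 1 \<and> deltaG G = {1..b}))"
  using group.Uk_interval[OF assms(1,2)] group.deltaG_interval[OF assms] by blast

end
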